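(* Let $G = G_n$ be the random graph on $n$ vertices with edge probability $p = p_n$ and i.i.d. edge weights $w(h) \ge 1$ as described in the context, and let $\chi_w(G)$ be its weighted colouring number. (a) Let $0<\beta<1$, $C,c>0$ be constants and let $s \geq 2$ be an integer constant. Suppose $p \geq \frac{1}{n^{\beta}}$ and $\mathbb{E}\,w^{2s+c}(h) \leq C$. If $\beta < 1-\frac{1}{s+\frac12-\frac{1}{2s}}$, then for every $\epsilon > 0$ there is a constant $D > 0$ (not depending on $n$) such that for all sufficiently large $n$, $$\mathbb{P}\left(\chi_w(G) \leq 2\mu np(1+\epsilon)\right) \geq 1- \frac{1}{n^{D}},$$ where $\mu := \mathbb{E}w(h)$ is the expected edge weight. (b) Let $0<\beta<1$, $A>0$ and $s>1$ be (real) constants. Suppose $p = \frac{1}{n^{\beta}}$ and $\mathbb{P}(w(h) \geq x) \geq \frac{A}{x^{2s}}$ for all $x \ge 1$. If $\beta > 1-\frac{1}{2s-1}$, then there are constants $\theta_1,\theta_2 > 0$ (not depending on $n$) such that for all sufficiently large $n$, $$\mathbb{P}\left(\chi_w(G) \geq n^{\theta_1} \cdot np\right) \geq 1- \exp\left(-n^{\theta_2}\right).$$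
   Context: Let $K_n$ be the complete graph on $n$ vertices. Let $\{X_h\}$, indexed by the edges $h$ of $K_n$, be i.i.d. Bernoulli random variables with $\mathbb{P}(X_h=1)=p=1-\mathbb{P}(X_h=0)$, where $0\le p\le 1$ may depend on $n$. The $\binom{n}{2}$ edges of $K_n$ are also equipped with i.i.d. real-valued random weights $\{w(h)\}$, independent of $\{X_h\}$, satisfying $w(h)\ge 1$ almost surely; the common law of the weights does not depend on $n$. $\mathbb{P}$ denotes the joint probability measure of $\{X_h\}$ and $\{w(h)\}$. The random graph $G$ is the subgraph of $K_n$ (on all $n$ vertices) consisting of all edges $h$ with $X_h=1$. For an edge $h=(u,v)$ write $w(u,v)=w(h)$. A map $f$ from the vertex set of $G$ to the set of positive integers $\{1,2,\ldots\}$ is a proper weighted colouring of $G$ if $|f(u)-f(v)|\ge w(u,v)$ for every edge $(u,v)$ of $G$. The weighted colouring number of $G$ is $$\chi_w(G):=\inf_f \max_{u} f(u),$$ where the maximum is over all $n$ vertices $u$ and the infimum is over all proper weighted colourings $f$ of $G$. *)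

theory Defs
  imports "HOL-Probability.Probability"
begin

definition all_edges :: "'v set \<Rightarrow> 'v set set" where
  "all_edges V = {e. e \<subseteq> V \<and> card e = 2}"

definition proper_weighted_colouring ::
    "'v set \<Rightarrow> 'v set set \<Rightarrow> ('v set \<Rightarrow> real) \<Rightarrow> ('v \<Rightarrow> nat) \<Rightarrow> bool" where
  "proper_weighted_colouring V E w f \<longleftrightarrow>
     (\<forall>u\<in>V. 1 \<le> f u) \<and>
     (\<forall>u v. {u, v} \<in> E \<longrightarrow> w {u, v} \<le> \<bar>real (f u) - real (f v)\<bar>)"

text \<open>The infimum is taken in the natural numbers, where it is only meaningful for a nonempty
  set; see the existence lemma below. The maximum is only meaningful for nonempty \<open>V\<close>.\<close>

definition weighted_colouring_number ::
    "'v set \<Rightarrow> 'v set set \<Rightarrow> ('v set \<Rightarrow> real) \<Rightarrow> nat" where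
  "weighted_colouring_number V E w =
     (INF f\<in>{f. proper_weighted_colouring V E w f}. Max (f ` V))"

lemma proper_weighted_colouring_exists:
  assumes "finite V" "E \<subseteq> all_edges V"
  shows "\<exists>f. proper_weighted_colouring V E w f"
proof -
  have "all_edges V \<subseteq> Pow V"
    by (auto simp: all_edges_def)
  with assms have fin: "finite E"
    by (meson finite_Pow_iff finite_subset)
  obtain g :: "'a \<Rightarrow> nat" where g: "inj_on g V"
    using finite_imp_inj_to_nat_seg[OF assms(1)] by blast
  define K where "K = nat \<lceil>\<Sum>e\<in>E. \<bar>w e\<bar>\<rceil>"
  have K: "w e \<le> real K" if "e \<in> E" for e
  proof -
    have "\<bar>w e\<bar> \<le> (\<Sum>e\<in>E. \<bar>w e\<bar>)"
      using that fin by (intro member_le_sum) auto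
    then show ?thesis
      unfolding K_def by linarith
  qed
  have "w {u, v} \<le> \<bar>real (1 + K * g u) - real (1 + K * g v)\<bar>" if "{u, v} \<in> E" for u v
  proof -
    have "u \<in> V" "v \<in> V" "u \<noteq> v"
      using that assms(2) by (auto simp: all_edges_def)
    then have "g u \<noteq> g v"
      using g by (meson inj_onD)
    then have "1 \<le> \<bar>real (g u) - real (g v)\<bar>"
      by linarith
    then have "real K * 1 \<le> real K * \<bar>real (g u) - real (g v)\<bar>"
      by (intro mult_left_mono) auto
    also have "\<dots> = \<bar>real (1 + K * g u) - real (1 + K * g v)\<bar>"
      by (simp add: abs_mult flip: right_diff_distrib)
    finally show ?thesis
      using K[OF that] by linarith
  qed
  then show ?thesis
    unfolding proper_weighted_colouring_def by (intro exI[of _ "\<lambda>u. 1 + K * g u"]) auto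
qed

text \<open>\<open>L\<close> is the common law of the weights. The event \<open>X e = 1\<close> means that the edge \<open>e\<close> of the complete
  graph on \<open>{1..n}\<close> is present.\<close>

locale weighted_random_graph = prob_space M for M :: "'a measure" +
  fixes n :: nat and p :: real and L :: "real measure"
    and X :: "nat set \<Rightarrow> 'a \<Rightarrow> real" and w :: "nat set \<Rightarrow> 'a \<Rightarrow> real"
  assumes p_bounds: "0 \<le> p" "p \<le> 1"
    and indep_X: "indep_vars (\<lambda>_. borel) X (all_edges {1..n})"
    and prob_X_1: "e \<in> all_edges {1..n} \<Longrightarrow> prob {\<omega> \<in> space M. X e \<omega> = 1} = p"
    and prob_X_0: "e \<in> all_edges {1..n} \<Longrightarrow> prob {\<omega> \<in> space M. X e \<omega> = 0} = 1 - p"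
    and indep_w: "indep_vars (\<lambda>_. borel) w (all_edges {1..n})"
    and distr_w: "e \<in> all_edges {1..n} \<Longrightarrow> distr M borel (w e) = L"
    and w_ge_1: "e \<in> all_edges {1..n} \<Longrightarrow> AE \<omega> in M. 1 \<le> w e \<omega>"
    and indep_X_w: "indep_var
          (PiM (all_edges {1..n}) (\<lambda>_. borel)) (\<lambda>\<omega>. \<lambda>e\<in>all_edges {1..n}. X e \<omega>)
          (PiM (all_edges {1..n}) (\<lambda>_. borel)) (\<lambda>\<omega>. \<lambda>e\<in>all_edges {1..n}. w e \<omega>)"

definition random_edges :: "nat \<Rightarrow> (nat set \<Rightarrow> 'a \<Rightarrow> real) \<Rightarrow> 'a \<Rightarrow> nat set set" where
  "random_edges n X \<omega> = {e \<in> all_edges {1..n}. X e \<omega> = 1}"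

definition random_colouring_number ::
    "nat \<Rightarrow> (nat set \<Rightarrow> 'a \<Rightarrow> real) \<Rightarrow> (nat set \<Rightarrow> 'a \<Rightarrow> real) \<Rightarrow> 'a \<Rightarrow> nat" where
  "random_colouring_number n X w \<omega> =
     weighted_colouring_number {1..n} (random_edges n X \<omega>) (\<lambda>e. w e \<omega>)"

end

theory Submission
  imports Defs "HOL-Real_Asymp.Real_Asymp"
begin

text \<open>Upper bound: a greedy colouring that uses the colours in increasing order needs at most
  \<open>1 + max\<^sub>u (\<Sum>v. \<lceil>w(u, v)\<rceil>)\<close> colours, because each neighbour blocks only an interval to the right of its
  own colour; as \<open>w \<ge> 1\<close>, this is at most one plus twice the largest weighted degree. With
  \<open>y = (np) powr (2s / (2s + c))\<close>, Markov's inequality and the moment of order \<open>2s + c\<close> exclude present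
  edges of weight above \<open>y\<close>: their expected number is at most \<open>C n (np) powr (1 - 2s)\<close>, a negative
  power of \<open>n\<close>. The weighted degrees truncated at \<open>y\<close> exceed \<open>\<mu>np(1 + \<epsilon>/2)\<close> only with stretched
  exponentially small probability, by the exponential Markov inequality with parameter \<open>1 / y\<close>.

  Lower bound: the colouring number is at least the weight of any present edge, and the number of
  present edges of weight at least \<open>n powr \<theta>\<^sub>1 * (np)\<close> has expectation at least a positive power of \<open>n\<close>,
  so that by independence such an edge is missing only with exponentially small probability.\<close>

section \<open>Deterministic bounds on the weighted colouring number\<close>

text \<open>An infimum of a nonempty set of naturals is attained, so bounding the colouring number
  amounts to exhibiting one colouring. The greedy bound and the measurability proof both use this
  form instead of \<open>INF\<close>.\<close>

lemma weighted_colouring_number_le_iff: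
  assumes "finite V" "V \<noteq> {}" "E \<subseteq> all_edges V"
  shows "weighted_colouring_number V E w \<le> k \<longleftrightarrow>
    (\<exists>f. proper_weighted_colouring V E w f \<and> (\<forall>u\<in>V. f u \<le> k))"
proof
  let ?A = "(\<lambda>f. Max (f ` V)) ` {f. proper_weighted_colouring V E w f}"
  assume "weighted_colouring_number V E w \<le> k"
  moreover have "Inf ?A \<in> ?A"
    using proper_weighted_colouring_exists[OF assms(1,3), of w] by (intro Inf_nat_def1) auto
  ultimately obtain f where "proper_weighted_colouring V E w f" "Max (f ` V) \<le> k"
    by (auto simp: weighted_colouring_number_def)
  then show "\<exists>f. proper_weighted_colouring V E w f \<and> (\<forall>u\<in>V. f u \<le> k)"
    using assms(1,2) by auto
next
  assume "\<exists>f. proper_weighted_colouring V E w f \<and> (\<forall>u\<in>V. f u \<le> k)"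
  then obtain f where f: "proper_weighted_colouring V E w f" "\<forall>u\<in>V. f u \<le> k"
    by auto
  have "weighted_colouring_number V E w \<le> Max (f ` V)"
    unfolding weighted_colouring_number_def using f(1) by (intro cINF_lower) auto
  also have "\<dots> \<le> k"
    using f(2) assms(1,2) by simp
  finally show "weighted_colouring_number V E w \<le> k" .
qed

text \<open>The colours are handed out in increasing order, so a coloured neighbour \<open>v\<close> of \<open>u\<close> blocks
  for \<open>u\<close> only colours in the one-sided interval from \<open>f v\<close> to \<open>f v + w {u, v}\<close>.\<close>

lemma one_sided_greedy_colouring:
  assumes "finite V" "E \<subseteq> all_edges V" "\<forall>e\<in>E. 0 < w e"
  shows "\<exists>S f. S \<subseteq> V \<and> (\<forall>u\<in>S. 1 \<le> f u \<and> f u \<le> (k::nat)) \<and>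
    (\<forall>u\<in>S. \<forall>v\<in>S. {u, v} \<in> E \<longrightarrow> w {u, v} \<le> \<bar>real (f u) - real (f v)\<bar>) \<and>
    (\<forall>u\<in>V - S. \<forall>j\<in>{1..k}. \<exists>v\<in>S. {u, v} \<in> E \<and> f v \<le> j \<and> real j < real (f v) + w {u, v})"
proof (induction k)
  case 0
  then show ?case by (intro exI[of _ "{}"]) auto
next
  case (Suc k)
  from Suc.IH obtain S and f :: "'a \<Rightarrow> nat" where S: "S \<subseteq> V"
    and f_all: "\<forall>u\<in>S. 1 \<le> f u \<and> f u \<le> k"
    and proper_all: "\<forall>u\<in>S. \<forall>v\<in>S. {u, v} \<in> E \<longrightarrow> w {u, v} \<le> \<bar>real (f u) - real (f v)\<bar>"
    and blocked_all: "\<forall>u\<in>V - S. \<forall>j\<in>{1..k}.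
      \<exists>v\<in>S. {u, v} \<in> E \<and> f v \<le> j \<and> real j < real (f v) + w {u, v}"
    by (elim exE conjE) (rule that)
  note f = f_all[rule_format] and proper = proper_all[rule_format]
    and blocked = blocked_all[rule_format]
  \<comment> \<open>\<open>B\<close> holds the uncoloured vertices to which colour
    \<open>Suc k\<close> is still open. A maximal independent subset \<open>I\<close> of
    \<open>B\<close> gets it: independence keeps the colouring proper, maximality leaves every other
    vertex of \<open>B\<close> with a neighbour in \<open>I\<close>.\<close>
  define B where "B = {u \<in> V - S. \<forall>v\<in>S. {u, v} \<in> E \<longrightarrow> real (f v) + w {u, v} \<le> real (Suc k)}"
  define Z where "Z = {A. A \<subseteq> B \<and> (\<forall>u\<in>A. \<forall>v\<in>A. {u, v} \<notin> E)}"
  have "B \<subseteq> V" by (auto simp: B_def)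
  then have "finite B" using assms(1) finite_subset by blast
  then have "finite Z" by (auto simp: Z_def)
  moreover have "{} \<in> Z" by (auto simp: Z_def)
  ultimately obtain I where I: "I \<in> Z" "\<And>A. A \<in> Z \<Longrightarrow> I \<subseteq> A \<Longrightarrow> I = A"
    using finite_has_maximal[of Z] by blast
  define g where "g u = (if u \<in> I then Suc k else f u)" for u
  have IB: "I \<subseteq> B" and indep: "\<And>u v. u \<in> I \<Longrightarrow> v \<in> I \<Longrightarrow> {u, v} \<notin> E"
    using I(1) by (auto simp: Z_def)
  have disj: "u \<notin> I" if "u \<in> S" for u
    using that IB by (auto simp: B_def)
  have cross: "w {u, v} \<le> \<bar>real (g u) - real (g v)\<bar>" if "u \<in> I" "v \<in> S" "{u, v} \<in> E" for u v
  proof -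
    have "real (f v) + w {u, v} \<le> real (Suc k)"
      using that IB by (auto simp: B_def)
    then show ?thesis using that disj[of v] by (simp add: g_def)
  qed
  show ?case
  proof (intro exI[of _ "S \<union> I"] exI[of _ g] conjI ballI impI)
    show "S \<union> I \<subseteq> V" using S IB \<open>B \<subseteq> V\<close> by blast
  next
    fix u assume "u \<in> S \<union> I"
    then show "1 \<le> g u" "g u \<le> Suc k" using f by (force simp: g_def)+
  next
    fix u v assume uv: "u \<in> S \<union> I" "v \<in> S \<union> I" "{u, v} \<in> E"
    consider "u \<in> S" "v \<in> S" | "u \<in> I" "v \<in> S" | "u \<in> S" "v \<in> I"
      using uv indep by blast
    then show "w {u, v} \<le> \<bar>real (g u) - real (g v)\<bar>"
    proof cases
      case 1
      then show ?thesis using proper[OF 1 uv(3)] disj by (simp add: g_def)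
    next
      case 2
      then show ?thesis using cross uv(3) by blast
    next
      case 3
      then show ?thesis using cross[of v u] uv(3) by (simp add: insert_commute abs_minus_commute)
    qed
  next
    fix u j assume u: "u \<in> V - (S \<union> I)" and j: "j \<in> {1..Suc k}"
    show "\<exists>v\<in>S \<union> I. {u, v} \<in> E \<and> g v \<le> j \<and> real j < real (g v) + w {u, v}"
    proof (cases "j = Suc k")
      case False
      then obtain v where "v \<in> S" "{u, v} \<in> E" "f v \<le> j" "real j < real (f v) + w {u, v}"
        using blocked[of u j] u j by auto
      then show ?thesis using disj[of v] by (intro bexI[of _ v]) (auto simp: g_def)
    next
      case j: True
      show ?thesis
      proof (cases "u \<in> B")
        case True
        \<comment> \<open>By maximality \<open>u\<close> has a neighbour \<open>v\<close> in
          \<open>I\<close>. The colour of \<open>v\<close> is \<open>j\<close> itself, so positivity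
          of the weight gives the strict inequality.\<close>
        have "insert u I \<notin> Z" using I(2)[of "insert u I"] u by auto
        then obtain a b where ab: "a \<in> insert u I" "b \<in> insert u I" "{a, b} \<in> E"
          using True IB unfolding Z_def by blast
        have "{u, u} \<notin> E"
          using assms(2) by (auto simp: all_edges_def)
        then obtain v where "v \<in> I" "{u, v} \<in> E"
          using ab indep by (metis insert_commute insertE)
        then show ?thesis using assms(3) j by (intro bexI[of _ v]) (auto simp: g_def)
      next
        case False
        then obtain v where "v \<in> S" "{u, v} \<in> E" "real (Suc k) < real (f v) + w {u, v}"
          using u by (auto simp: B_def not_le)
        then show ?thesis using f[of v] disj[of v] j by (intro bexI[of _ v]) (auto simp: g_def)
      qed
    qed
  qed
qed

text \<open>Run the greedy process with \<open>Suc T\<close> colours. A vertex left over would have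
  all \<open>Suc T\<close> colours covered by the intervals that its neighbours block, and these
  contain at most \<open>T\<close> integers in total.\<close>

lemma weighted_colouring_number_le_Suc:
  assumes "finite V" "V \<noteq> {}" "E \<subseteq> all_edges V" "\<And>e. e \<in> E \<Longrightarrow> 0 < w e"
    and deg: "\<And>u. u \<in> V \<Longrightarrow> (\<Sum>v | {u, v} \<in> E. nat \<lceil>w {u, v}\<rceil>) \<le> T"
  shows "weighted_colouring_number V E w \<le> Suc T"
proof -
  have pos: "\<forall>e\<in>E. 0 < w e" using assms(4) by blast
  from one_sided_greedy_colouring[where V = V and E = E and w = w and k = "Suc T", OF assms(1,3) pos]
  obtain S and f :: "'a \<Rightarrow> nat" where S: "S \<subseteq> V"
    and f_all: "\<forall>u\<in>S. 1 \<le> f u \<and> f u \<le> Suc T"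
    and proper_all: "\<forall>u\<in>S. \<forall>v\<in>S. {u, v} \<in> E \<longrightarrow> w {u, v} \<le> \<bar>real (f u) - real (f v)\<bar>"
    and blocked_all: "\<forall>u\<in>V - S. \<forall>j\<in>{1..Suc T}.
      \<exists>v\<in>S. {u, v} \<in> E \<and> f v \<le> j \<and> real j < real (f v) + w {u, v}"
    by (elim exE conjE) (rule that)
  note f = f_all[rule_format] and proper = proper_all[rule_format]
    and blocked = blocked_all[rule_format]
  have ends: "u \<in> V" "v \<in> V" if "{u, v} \<in> E" for u v
    using that assms(3) by (auto simp: all_edges_def)
  have "V \<subseteq> S"
  proof
    fix u assume u: "u \<in> V"
    show "u \<in> S"
    proof (rule ccontr)
      assume "u \<notin> S"
      let ?N = "{v. {u, v} \<in> E}"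
      have "finite ?N" using ends by (intro finite_subset[OF _ assms(1)]) auto
      have sub: "{1..Suc T} \<subseteq> (\<Union>v\<in>?N. {f v..<f v + nat \<lceil>w {u, v}\<rceil>})"
      proof
        fix j assume "j \<in> {1..Suc T}"
        then obtain v where v: "{u, v} \<in> E" "f v \<le> j" "real j < real (f v) + w {u, v}"
          using blocked[of u j] u \<open>u \<notin> S\<close> by auto
        \<comment> \<open>The half-open interval of length \<open>w {u, v}\<close> starting at the
          integer \<open>f v\<close> contains exactly as many integers as the ceiling of its
          length.\<close>
        have "j < f v + nat \<lceil>w {u, v}\<rceil>" using v(3) by linarith
        then show "j \<in> (\<Union>v\<in>?N. {f v..<f v + nat \<lceil>w {u, v}\<rceil>})" using v by auto
      qed
      have "card {1..Suc T} \<le> card (\<Union>v\<in>?N. {f v..<f v + nat \<lceil>w {u, v}\<rceil>})"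
        using \<open>finite ?N\<close> by (intro card_mono[OF _ sub]) auto
      also have "\<dots> \<le> (\<Sum>v\<in>?N. card {f v..<f v + nat \<lceil>w {u, v}\<rceil>})"
        using \<open>finite ?N\<close> by (rule card_UN_le)
      also have "\<dots> \<le> T" using deg[OF u] by simp
      finally show False by simp
    qed
  qed
  then have "proper_weighted_colouring V E w f"
    unfolding proper_weighted_colouring_def using f proper ends by blast
  then show ?thesis
    using f \<open>V \<subseteq> S\<close> by (subst weighted_colouring_number_le_iff[OF assms(1-3)]) blast
qed

text \<open>Rounding a weight that is at least 1 up to an integer at most doubles it. This is the
  source of the factor 2 in the final bound.\<close>

lemma weighted_colouring_number_le_weighted_degree:
  assumes "finite V" "V \<noteq> {}" "E \<subseteq> all_edges V" "\<And>e. e \<in> E \<Longrightarrow> 1 \<le> w e"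
    and deg: "\<And>u. u \<in> V \<Longrightarrow> (\<Sum>v | {u, v} \<in> E. w {u, v}) \<le> B"
  shows "real (weighted_colouring_number V E w) \<le> 2 * B + 1"
proof -
  obtain u where "u \<in> V" using assms(2) by auto
  have "0 \<le> (\<Sum>v | {u, v} \<in> E. w {u, v})"
    by (intro sum_nonneg) (use assms(4) in force)
  then have "0 \<le> B" using deg[OF \<open>u \<in> V\<close>] by linarith
  have "(\<Sum>v | {u, v} \<in> E. nat \<lceil>w {u, v}\<rceil>) \<le> nat \<lfloor>2 * B\<rfloor>" if "u \<in> V" for u
  proof -
    have "real (\<Sum>v | {u, v} \<in> E. nat \<lceil>w {u, v}\<rceil>) \<le> (\<Sum>v | {u, v} \<in> E. 2 * w {u, v})"
      unfolding of_nat_sum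
    proof (rule sum_mono)
      fix v assume "v \<in> {v. {u, v} \<in> E}"
      then have "1 \<le> w {u, v}" using assms(4) by auto
      then show "real (nat \<lceil>w {u, v}\<rceil>) \<le> 2 * w {u, v}" by linarith
    qed
    also have "\<dots> \<le> 2 * B"
      using deg[OF that] by (simp flip: sum_distrib_left)
    finally show ?thesis by linarith
  qed
  then have "weighted_colouring_number V E w \<le> Suc (nat \<lfloor>2 * B\<rfloor>)"
    using assms(4) by (intro weighted_colouring_number_le_Suc assms(1-3)) force+
  then show ?thesis using \<open>0 \<le> B\<close> by linarith
qed

text \<open>In an optimal colouring all colours lie between 0 and the colouring number, so no two of
  them differ by more than that number.\<close>

lemma weighted_colouring_number_ge_weight:
  assumes "finite V" "E \<subseteq> all_edges V" "e \<in> E"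
  shows "w e \<le> real (weighted_colouring_number V E w)"
proof -
  have "card e = 2" using assms by (auto simp: all_edges_def)
  then obtain u v where e: "e = {u, v}" by (auto simp: card_2_iff)
  then have uv: "u \<in> V" "v \<in> V" using assms by (auto simp: all_edges_def)
  then have "V \<noteq> {}" by auto
  obtain f where f: "proper_weighted_colouring V E w f"
      "\<forall>u\<in>V. f u \<le> weighted_colouring_number V E w"
    using weighted_colouring_number_le_iff[OF assms(1) \<open>V \<noteq> {}\<close> assms(2)] by blast
  have "w e \<le> \<bar>real (f u) - real (f v)\<bar>"
    using f(1) assms(3) e by (auto simp: proper_weighted_colouring_def)
  moreover have "f u \<le> weighted_colouring_number V E w" "f v \<le> weighted_colouring_number V E w"
    using f(2) uv by auto
  ultimately show ?thesis by linarith
qed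

lemma finite_all_edges: "finite V \<Longrightarrow> finite (all_edges V)"
  by (rule finite_subset[of _ "Pow V"]) (auto simp: all_edges_def)

lemma card_all_edges: "finite V \<Longrightarrow> card (all_edges V) = card V choose 2"
  by (simp add: all_edges_def n_subsets)

section \<open>Joint independence of presence and weight\<close>

text \<open>The model supplies independence inside \<open>X\<close>, inside \<open>W\<close>, and
  between the two vectors. Indexing by a disjoint sum merges these into one family that can be
  regrouped. A finite intersection of events is a cylinder for \<open>X\<close> met with one for
  \<open>W\<close>: first the pair factors, then each cylinder.\<close>

lemma (in prob_space) indep_vars_Plus:
  assumes X: "indep_vars N X I" and W: "indep_vars K W J"
    and XW: "indep_var (PiM I N) (\<lambda>\<omega>. \<lambda>i\<in>I. X i \<omega>) (PiM J K) (\<lambda>\<omega>. \<lambda>j\<in>J. W j \<omega>)"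
  shows "indep_vars (case_sum N K) (case_sum X W) (I <+> J)"
  unfolding indep_vars_def2
proof (intro conjI ballI indep_setsI)
  have rvX: "random_variable (N i) (X i)" if "i \<in> I" for i
    using X that by (auto simp: indep_vars_def)
  have rvW: "random_variable (K j) (W j)" if "j \<in> J" for j
    using W that by (auto simp: indep_vars_def)
  show rv: "random_variable (case_sum N K i) (case_sum X W i)" if "i \<in> I <+> J" for i
    using that rvX rvW by (auto split: sum.split)
  show "{case_sum X W i -` A \<inter> space M |A. A \<in> sets (case_sum N K i)} \<subseteq> events"
    if "i \<in> I <+> J" for i
    using rv[OF that] by (auto dest: measurable_sets)
  fix A H
  assume H: "H \<noteq> {}" "H \<subseteq> I <+> J" "finite H"
    and "\<forall>h\<in>H. A h \<in> {case_sum X W h -` B \<inter> space M |B. B \<in> sets (case_sum N K h)}"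
  then obtain B where A: "\<And>h. h \<in> H \<Longrightarrow> A h = case_sum X W h -` B h \<inter> space M"
      and B: "\<And>h. h \<in> H \<Longrightarrow> B h \<in> sets (case_sum N K h)"
    by simp metis
  define I' where "I' = Inl -` H"
  define J' where "J' = Inr -` H"
  have sub: "I' \<subseteq> I" "J' \<subseteq> J" using H(2) by (auto simp: I'_def J'_def)
  have fin: "finite I'" "finite J'"
    using H(3) by (auto simp: I'_def J'_def intro: finite_vimageI)
  have H_eq: "H = Inl ` I' \<union> Inr ` J'"
  proof -
    have "h \<in> Inl ` I' \<union> Inr ` J'" if "h \<in> H" for h
      using that by (cases h) (auto simp: I'_def J'_def)
    then show ?thesis by (auto simp: I'_def J'_def)
  qed
  \<comment> \<open>Since \<open>XW\<close> speaks only of whole vectors, the constraints on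
    finitely many coordinates are packed into measurable subsets of the product spaces.\<close>
  define SX where "SX = {x \<in> space (PiM I N). \<forall>i\<in>I'. x i \<in> B (Inl i)}"
  define SW where "SW = {x \<in> space (PiM J K). \<forall>j\<in>J'. x j \<in> B (Inr j)}"
  have BX: "B (Inl i) \<in> sets (N i)" if "i \<in> I'" for i
    using that B[of "Inl i"] by (simp add: I'_def)
  have BW: "B (Inr j) \<in> sets (K j)" if "j \<in> J'" for j
    using that B[of "Inr j"] by (simp add: J'_def)
  have SX: "SX \<in> sets (PiM I N)"
    unfolding SX_def
  proof (intro sets.sets_Collect_finite_All fin)
    fix i assume "i \<in> I'"
    then have "(\<lambda>x. x i) -` B (Inl i) \<inter> space (PiM I N) \<in> sets (PiM I N)"
      using sub by (intro measurable_sets[OF measurable_component_singleton] BX) auto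
    then show "{x \<in> space (PiM I N). x i \<in> B (Inl i)} \<in> sets (PiM I N)"
      by (simp add: vimage_def Int_def conj_commute)
  qed
  have SW: "SW \<in> sets (PiM J K)"
    unfolding SW_def
  proof (intro sets.sets_Collect_finite_All fin)
    fix j assume "j \<in> J'"
    then have "(\<lambda>x. x j) -` B (Inr j) \<inter> space (PiM J K) \<in> sets (PiM J K)"
      using sub by (intro measurable_sets[OF measurable_component_singleton] BW) auto
    then show "{x \<in> space (PiM J K). x j \<in> B (Inr j)} \<in> sets (PiM J K)"
      by (simp add: vimage_def Int_def conj_commute)
  qed
  have spX: "(\<lambda>i\<in>I. X i \<omega>) \<in> space (PiM I N)" if "\<omega> \<in> space M" for \<omega>
    using that rvX by (auto simp: space_PiM dest: measurable_space)
  have spW: "(\<lambda>j\<in>J. W j \<omega>) \<in> space (PiM J K)" if "\<omega> \<in> space M" for \<omega>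
    using that rvW by (auto simp: space_PiM dest: measurable_space)
  have eqX: "(\<lambda>\<omega>. \<lambda>i\<in>I. X i \<omega>) -` SX \<inter> space M = {\<omega> \<in> space M. \<forall>i\<in>I'. X i \<omega> \<in> B (Inl i)}"
    using sub spX by (auto simp: SX_def)
  have eqW: "(\<lambda>\<omega>. \<lambda>j\<in>J. W j \<omega>) -` SW \<inter> space M = {\<omega> \<in> space M. \<forall>j\<in>J'. W j \<omega> \<in> B (Inr j)}"
    using sub spW by (auto simp: SW_def)
  \<comment> \<open>\<open>indep_varsD\<close> asks for a nonempty index set. Without any constraint
    on \<open>X\<close> the event is the whole space and the product is empty, so both sides are
    1.\<close>
  have prX: "prob {\<omega> \<in> space M. \<forall>i\<in>I'. X i \<omega> \<in> B (Inl i)} = (\<Prod>i\<in>I'. prob (A (Inl i)))"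
  proof (cases "I' = {}")
    case False
    have "{\<omega> \<in> space M. \<forall>i\<in>I'. X i \<omega> \<in> B (Inl i)} = (\<Inter>i\<in>I'. X i -` B (Inl i) \<inter> space M)"
      using False by auto
    also have "prob \<dots> = (\<Prod>i\<in>I'. prob (X i -` B (Inl i) \<inter> space M))"
      using indep_varsD[OF X False fin(1) sub(1), of "\<lambda>i. B (Inl i)"] BX by blast
    also have "\<dots> = (\<Prod>i\<in>I'. prob (A (Inl i)))"
      by (intro prod.cong) (auto simp: A I'_def)
    finally show ?thesis .
  qed (simp add: prob_space)
  have prW: "prob {\<omega> \<in> space M. \<forall>j\<in>J'. W j \<omega> \<in> B (Inr j)} = (\<Prod>j\<in>J'. prob (A (Inr j)))"
  proof (cases "J' = {}")
    case False
    have "{\<omega> \<in> space M. \<forall>j\<in>J'. W j \<omega> \<in> B (Inr j)} = (\<Inter>j\<in>J'. W j -` B (Inr j) \<inter> space M)"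
      using False by auto
    also have "prob \<dots> = (\<Prod>j\<in>J'. prob (W j -` B (Inr j) \<inter> space M))"
      using indep_varsD[OF W False fin(2) sub(2), of "\<lambda>j. B (Inr j)"] BW by blast
    also have "\<dots> = (\<Prod>j\<in>J'. prob (A (Inr j)))"
      by (intro prod.cong) (auto simp: A J'_def)
    finally show ?thesis .
  qed (simp add: prob_space)
  have "(\<Inter>h\<in>H. A h) = (\<Inter>h\<in>H. case_sum X W h -` B h \<inter> space M)"
    using A by auto
  also have "\<dots> = (\<lambda>\<omega>. (\<lambda>i\<in>I. X i \<omega>, \<lambda>j\<in>J. W j \<omega>)) -` (SX \<times> SW) \<inter> space M"
  proof -
    have "(\<Inter>h\<in>H. case_sum X W h -` B h \<inter> space M) =
      {\<omega> \<in> space M. \<forall>h\<in>H. case_sum X W h \<omega> \<in> B h}"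
      using H(1) by auto
    also have "\<dots> = {\<omega> \<in> space M. (\<forall>i\<in>I'. X i \<omega> \<in> B (Inl i)) \<and> (\<forall>j\<in>J'. W j \<omega> \<in> B (Inr j))}"
      by (simp add: H_eq ball_Un)
    also have "\<dots> = (\<lambda>\<omega>. (\<lambda>i\<in>I. X i \<omega>, \<lambda>j\<in>J. W j \<omega>)) -` (SX \<times> SW) \<inter> space M"
      using eqX eqW by blast
    finally show ?thesis .
  qed
  also have "prob \<dots> = (\<Prod>i\<in>I'. prob (A (Inl i))) * (\<Prod>j\<in>J'. prob (A (Inr j)))"
    using indep_varD[OF XW SX SW] unfolding eqX eqW prX prW .
  also have "\<dots> = (\<Prod>h\<in>H. prob (A h))"
    unfolding H_eq using fin
    by (subst prod.union_disjoint) (auto simp: prod.reindex)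
  finally show "prob (\<Inter>h\<in>H. A h) = (\<Prod>h\<in>H. prob (A h))" .
qed

text \<open>The coordinates \<open>Inl i\<close> and \<open>Inr i\<close> form disjoint blocks of
  the merged family, one per index. Blocks are independent, and so are measurable functions of
  them.\<close>

lemma (in prob_space) indep_vars_combine:
  fixes h :: "'i \<Rightarrow> 'b \<Rightarrow> 'b \<Rightarrow> 'c"
  assumes X: "indep_vars N X I" and W: "indep_vars K W I"
    and XW: "indep_var (PiM I N) (\<lambda>\<omega>. \<lambda>i\<in>I. X i \<omega>) (PiM I K) (\<lambda>\<omega>. \<lambda>i\<in>I. W i \<omega>)"
    and h: "\<And>i. i \<in> I \<Longrightarrow> (\<lambda>(a, b). h i a b) \<in> measurable (N i \<Otimes>\<^sub>M K i) (Q i)"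
  shows "indep_vars Q (\<lambda>i \<omega>. h i (X i \<omega>) (W i \<omega>)) I"
proof -
  let ?M = "case_sum N K" and ?K = "\<lambda>i. {Inl i, Inr i}"
  have "indep_vars (\<lambda>i. PiM (?K i) ?M) (\<lambda>i \<omega>. restrict (\<lambda>j. case_sum X W j \<omega>) (?K i)) I"
    by (rule indep_vars_restrict[OF indep_vars_Plus[OF X W XW]])
      (auto simp: disjoint_family_on_def)
  then have "indep_vars Q (\<lambda>i \<omega>. (\<lambda>z. h i (z (Inl i)) (z (Inr i)))
      (restrict (\<lambda>j. case_sum X W j \<omega>) (?K i))) I"
  proof (rule indep_vars_compose2)
    fix i assume i: "i \<in> I"
    have 1: "(\<lambda>z. z (Inl i)) \<in> measurable (PiM (?K i) ?M) (N i)"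
      using measurable_component_singleton[of "Inl i" "?K i" ?M] by simp
    have 2: "(\<lambda>z. z (Inr i)) \<in> measurable (PiM (?K i) ?M) (K i)"
      using measurable_component_singleton[of "Inr i" "?K i" ?M] by simp
    show "(\<lambda>z. h i (z (Inl i)) (z (Inr i))) \<in> measurable (PiM (?K i) ?M) (Q i)"
      using measurable_compose[OF measurable_Pair[OF 1 2] h[OF i]] by simp
  qed
  then show ?thesis by simp
qed

section \<open>Probability bounds for a fixed number of vertices\<close>

context weighted_random_graph
begin

abbreviation "edges \<equiv> all_edges {1..n}"

section \<open>Single edges, measurability of the colouring number, and its lower bound\<close>

lemma finite_edges: "finite edges"
  by (simp add: finite_all_edges)

lemma measurable_X: "e \<in> edges \<Longrightarrow> X e \<in> borel_measurable M"
  using indep_X by (auto simp: indep_vars_def)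

lemma measurable_w: "e \<in> edges \<Longrightarrow> w e \<in> borel_measurable M"
  using indep_w by (auto simp: indep_vars_def)

lemma indep_X_w_edge:
  assumes e: "e \<in> edges"
  shows "indep_var borel (X e) borel (w e)"
proof -
  have "indep_var borel ((\<lambda>z. z e) \<circ> (\<lambda>\<omega>. \<lambda>e\<in>edges. X e \<omega>)) borel ((\<lambda>z. z e) \<circ> (\<lambda>\<omega>. \<lambda>e\<in>edges. w e \<omega>))"
    by (intro indep_var_compose[OF indep_X_w]) (use e in measurable)
  then show ?thesis using e by (simp add: comp_def)
qed

lemma indep_edges:
  fixes h :: "nat set \<Rightarrow> real \<Rightarrow> real \<Rightarrow> real"
  assumes "\<And>e. e \<in> edges \<Longrightarrow> (\<lambda>(a, b). h e a b) \<in> borel_measurable (borel \<Otimes>\<^sub>M borel)"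
  shows "indep_vars (\<lambda>_. borel) (\<lambda>e \<omega>. h e (X e \<omega>) (w e \<omega>)) edges"
  by (rule indep_vars_combine[OF indep_X indep_w indep_X_w]) (rule assms)

lemma prob_present_edge:
  assumes e: "e \<in> edges" and B: "B \<in> sets borel"
  shows "prob {\<omega> \<in> space M. X e \<omega> = 1 \<and> w e \<omega> \<in> B} = p * measure L B"
proof -
  have "prob {\<omega> \<in> space M. X e \<omega> \<in> {1} \<and> w e \<omega> \<in> B} =
    prob {\<omega> \<in> space M. X e \<omega> \<in> {1}} * prob {\<omega> \<in> space M. w e \<omega> \<in> B}"
    using B by (intro prob_indep_random_variable[OF indep_X_w_edge[OF e]]) auto
  moreover have "measure L B = prob {\<omega> \<in> space M. w e \<omega> \<in> B}"
    using B measurable_w[OF e]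
    by (subst distr_w[OF e, symmetric], subst measure_distr)
      (auto intro!: arg_cong[where f = prob])
  ultimately show ?thesis using prob_X_1[OF e] by simp
qed

text \<open>Whether the colouring number is at most \<open>k\<close> is decided by finitely many
  colourings with values up to \<open>k\<close>, so each sublevel set is a finite Boolean
  combination of edge events.\<close>

lemma measurable_random_colouring_number:
  assumes "n \<ge> 1"
  shows "(\<lambda>\<omega>. real (random_colouring_number n X w \<omega>)) \<in> borel_measurable M"
proof -
  let ?chi = "random_colouring_number n X w"
  let ?good = "\<lambda>f u v \<omega>. {u, v} \<in> random_edges n X \<omega> \<longrightarrow> w {u, v} \<omega> \<le> \<bar>real (f u) - real (f v)\<bar>"
  have meas: "{\<omega> \<in> space M. ?good f u v \<omega>} \<in> events" for f :: "nat \<Rightarrow> nat" and u v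
  proof (cases "{u, v} \<in> edges")
    case True
    note [measurable] = measurable_X[OF True] measurable_w[OF True]
    show ?thesis using True by (simp add: random_edges_def)
  qed (simp add: random_edges_def)
  have le: "{\<omega> \<in> space M. ?chi \<omega> \<le> k} \<in> events" for k
  proof -
    \<comment> \<open>Only the values on the vertices matter. Extensionality fixes the others, which
      makes the set finite.\<close>
    let ?F = "{f \<in> {1..n} \<rightarrow>\<^sub>E {..k}. \<forall>u\<in>{1..n}. 1 \<le> f u}"
    have iff: "?chi \<omega> \<le> k \<longleftrightarrow> (\<exists>f\<in>?F. \<forall>u\<in>{1..n}. \<forall>v\<in>{1..n}. ?good f u v \<omega>)" for \<omega>
    proof -
      have E: "random_edges n X \<omega> \<subseteq> edges" by (auto simp: random_edges_def)
      have "?chi \<omega> \<le> k \<longleftrightarrow> (\<exists>f. proper_weighted_colouring {1..n} (random_edges n X \<omega>) (\<lambda>e. w e \<omega>) f \<and>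
          (\<forall>u\<in>{1..n}. f u \<le> k))"
        unfolding random_colouring_number_def
        using assms E by (intro weighted_colouring_number_le_iff) auto
      also have "\<dots> \<longleftrightarrow> (\<exists>f\<in>?F. \<forall>u\<in>{1..n}. \<forall>v\<in>{1..n}. ?good f u v \<omega>)"
      proof
        assume "\<exists>f. proper_weighted_colouring {1..n} (random_edges n X \<omega>) (\<lambda>e. w e \<omega>) f \<and>
          (\<forall>u\<in>{1..n}. f u \<le> k)"
        then obtain f where "proper_weighted_colouring {1..n} (random_edges n X \<omega>) (\<lambda>e. w e \<omega>) f"
          "\<forall>u\<in>{1..n}. f u \<le> k" by blast
        then show "\<exists>f\<in>?F. \<forall>u\<in>{1..n}. \<forall>v\<in>{1..n}. ?good f u v \<omega>"
          by (intro bexI[of _ "restrict f {1..n}"]) (auto simp: proper_weighted_colouring_def)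
      next
        assume "\<exists>f\<in>?F. \<forall>u\<in>{1..n}. \<forall>v\<in>{1..n}. ?good f u v \<omega>"
        then obtain f where f: "f \<in> ?F" "\<forall>u\<in>{1..n}. \<forall>v\<in>{1..n}. ?good f u v \<omega>" by blast
        have "u \<in> {1..n} \<and> v \<in> {1..n}" if "{u, v} \<in> random_edges n X \<omega>" for u v
          using that E by (auto simp: all_edges_def)
        then have "proper_weighted_colouring {1..n} (random_edges n X \<omega>) (\<lambda>e. w e \<omega>) f"
          using f unfolding proper_weighted_colouring_def by blast
        moreover have "\<forall>u\<in>{1..n}. f u \<le> k" using f(1) by (auto simp: PiE_iff)
        ultimately show "\<exists>f. proper_weighted_colouring {1..n} (random_edges n X \<omega>) (\<lambda>e. w e \<omega>) f \<and>
          (\<forall>u\<in>{1..n}. f u \<le> k)" by blast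
      qed
      finally show ?thesis .
    qed
    have "finite ?F" by (intro finite_subset[OF _ finite_PiE[of "{1..n}" "\<lambda>_. {..k}"]]) auto
    then show ?thesis
      unfolding iff by (intro sets.sets_Collect_finite_Ex sets.sets_Collect_finite_All meas) auto
  qed
  show ?thesis
  proof (subst borel_measurable_iff_le, intro allI)
    fix a :: real
    show "{\<omega> \<in> space M. real (?chi \<omega>) \<le> a} \<in> events"
    proof (cases "a < 0")
      case True
      then have eq: "{\<omega> \<in> space M. real (?chi \<omega>) \<le> a} = {}" by auto
      show ?thesis unfolding eq by simp
    next
      case False
      then have "{\<omega> \<in> space M. real (?chi \<omega>) \<le> a} = {\<omega> \<in> space M. ?chi \<omega> \<le> nat \<lfloor>a\<rfloor>}"
        by (auto simp: le_nat_iff le_floor_iff)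
      then show ?thesis using le by simp
    qed
  qed
qed

text \<open>A colouring number below \<open>x\<close> forces every edge to be absent or lighter than
  \<open>x\<close>. These events are independent over the edges, and
  \<open>1 - q \<le> exp (- q)\<close> bounds the product of their probabilities.\<close>

lemma prob_colouring_number_ge:
  assumes "n \<ge> 2"
  shows "prob {\<omega> \<in> space M. x \<le> real (random_colouring_number n X w \<omega>)} \<ge>
    1 - exp (- (p * measure L {x..} * real (n choose 2)))"
proof -
  let ?chi = "random_colouring_number n X w"
  let ?q = "p * measure L {x..}"
  define h :: "nat set \<Rightarrow> real \<Rightarrow> real \<Rightarrow> real" where "h e a b = (if a = 1 \<and> x \<le> b then 1 else 0)" for e a b
  let ?H = "\<lambda>e \<omega>. h e (X e \<omega>) (w e \<omega>)"
  have indep: "indep_vars (\<lambda>_. borel) ?H edges"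
    by (rule indep_edges) (simp add: h_def)
  have "{1, 2} \<in> edges" using assms by (auto simp: all_edges_def)
  then have ne: "edges \<noteq> {}" by auto
  have [measurable]: "(\<lambda>\<omega>. real (?chi \<omega>)) \<in> borel_measurable M"
    using assms by (intro measurable_random_colouring_number) simp
  have meas: "{\<omega> \<in> space M. real (?chi \<omega>) < x} \<in> events"
    by measurable
  have prob0: "prob (?H e -` {0} \<inter> space M) = 1 - ?q" if e: "e \<in> edges" for e
  proof -
    note [measurable] = measurable_X[OF e] measurable_w[OF e]
    have "?H e -` {0} \<inter> space M = space M - {\<omega> \<in> space M. X e \<omega> = 1 \<and> w e \<omega> \<in> {x..}}"
      by (auto simp: h_def)
    also have "prob \<dots> = 1 - prob {\<omega> \<in> space M. X e \<omega> = 1 \<and> w e \<omega> \<in> {x..}}"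
      by (rule prob_compl) simp
    finally show ?thesis using prob_present_edge[OF e, of "{x..}"] by simp
  qed
  obtain e where e: "e \<in> edges" using ne by auto
  \<comment> \<open>The base must be nonnegative for the power bound below; it is the probability of
    an event at an actual edge.\<close>
  have q1: "0 \<le> 1 - ?q" using prob0[OF e] by (metis measure_nonneg)
  have "prob {\<omega> \<in> space M. real (?chi \<omega>) < x} \<le> prob (\<Inter>e\<in>edges. ?H e -` {0} \<inter> space M)"
  proof (rule finite_measure_mono)
    show "(\<Inter>e\<in>edges. ?H e -` {0} \<inter> space M) \<in> events"
    proof (rule sets.finite_INT[OF finite_edges ne])
      fix e assume "e \<in> edges"
      then have "?H e \<in> borel_measurable M" using indep by (auto simp: indep_vars_def)
      then show "?H e -` {0} \<inter> space M \<in> events" by (rule measurable_sets) simp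
    qed
    show "{\<omega> \<in> space M. real (?chi \<omega>) < x} \<subseteq> (\<Inter>e\<in>edges. ?H e -` {0} \<inter> space M)"
    proof (intro subsetI INT_I)
      fix \<omega> e assume \<omega>: "\<omega> \<in> {\<omega> \<in> space M. real (?chi \<omega>) < x}" and e: "e \<in> edges"
      have "w e \<omega> < x" if "X e \<omega> = 1"
      proof -
        have "w e \<omega> \<le> real (?chi \<omega>)"
          unfolding random_colouring_number_def
          by (rule weighted_colouring_number_ge_weight) (use e that in \<open>auto simp: random_edges_def\<close>)
        then show ?thesis using \<omega> by simp
      qed
      then show "\<omega> \<in> ?H e -` {0} \<inter> space M" using \<omega> by (force simp: h_def)
    qed
  qed
  also have "\<dots> = (\<Prod>e\<in>edges. prob (?H e -` {0} \<inter> space M))"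
    by (rule indep_varsD_finite[OF indep ne finite_edges]) simp
  also have "\<dots> = (1 - ?q) ^ (n choose 2)"
    by (simp add: prob0 card_all_edges)
  also have "\<dots> \<le> exp (- ?q) ^ (n choose 2)"
    using q1 exp_ge_add_one_self[of "- ?q"] by (intro power_mono) simp_all
  also have "\<dots> = exp (- (?q * real (n choose 2)))"
    by (simp flip: exp_of_nat_mult add: mult.commute)
  finally have le: "prob {\<omega> \<in> space M. real (?chi \<omega>) < x} \<le> exp (- (?q * real (n choose 2)))" .
  have "{\<omega> \<in> space M. x \<le> real (?chi \<omega>)} = space M - {\<omega> \<in> space M. real (?chi \<omega>) < x}"
    by auto
  then show ?thesis using prob_compl[OF meas] le by simp
qed

section \<open>Exponential tail bound for truncated weighted degrees\<close>

lemma integrable_weight: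
  assumes e: "e \<in> edges" and g: "integrable L g" "g \<in> borel_measurable borel"
  shows "integrable M (\<lambda>\<omega>. g (w e \<omega>) :: real)" "(\<integral>\<omega>. g (w e \<omega>) \<partial>M) = (\<integral>x. g x \<partial>L)"
  using g measurable_w[OF e] unfolding distr_w[OF e, symmetric]
  by (simp_all add: integrable_distr_eq integral_distr)

text \<open>Truncating at \<open>y\<close> makes the exponential moment with parameter \<open>1 / y\<close> finite, and the bound
  \<open>exp z \<le> 1 + z + z\<^sup>2\<close> for \<open>0 \<le> z \<le> 1\<close> applies.\<close>

definition truncated_weight :: "real \<Rightarrow> real \<Rightarrow> real \<Rightarrow> real" where
  "truncated_weight y a b = (if a = 1 then min b y else 0)"

lemma truncated_weight_measurable [measurable]:
  "(\<lambda>(a, b). truncated_weight y a b) \<in> borel_measurable (borel \<Otimes>\<^sub>M borel)"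
  unfolding truncated_weight_def by measurable

text \<open>\<open>Y\<close> is at most 1 plus a quadratic in the weight that counts only when the
  edge is present. Independence of presence and weight turns its mean into \<open>p\<close> times
  moments of \<open>L\<close>, and \<open>1 + x \<le> exp x\<close> gives a form that multiplies
  well.\<close>

lemma exp_moment_truncated_weight:
  assumes e: "e \<in> edges" and y: "0 < y"
    and L: "integrable L (\<lambda>x. x)" "integrable L (\<lambda>x. x\<^sup>2)"
  defines "Y \<equiv> \<lambda>\<omega>. exp (truncated_weight y (X e \<omega>) (w e \<omega>) / y)"
  shows "integrable M Y"
    and "(\<integral>\<omega>. Y \<omega> \<partial>M) \<le> exp (p * ((\<integral>x. x \<partial>L) / y + (\<integral>x. x\<^sup>2 \<partial>L) / y\<^sup>2))"
proof -
  note [measurable] = measurable_X[OF e] measurable_w[OF e]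
  \<comment> \<open>\<open>g\<close> is the part \<open>z + z\<^sup>2\<close> of the bound with the
    truncation dropped, so that only the moments of \<open>L\<close> enter.\<close>
  define g where "g x = x / y + x\<^sup>2 / y\<^sup>2" for x :: real
  have g_meas [measurable]: "g \<in> borel_measurable borel" unfolding g_def by measurable
  have gL: "integrable L g"
    unfolding g_def by (intro Bochner_Integration.integrable_add integrable_divide_zero L) 
  have intg: "(\<integral>x. g x \<partial>L) = (\<integral>x. x \<partial>L) / y + (\<integral>x. x\<^sup>2 \<partial>L) / y\<^sup>2"
    unfolding g_def using L by simp
  let ?I = "\<lambda>\<omega>. indicator {1} (X e \<omega>) :: real"
  have "indep_var borel (indicator {1 :: real} \<circ> X e) borel (g \<circ> w e)"
    by (intro indep_var_compose[OF indep_X_w_edge[OF e]]) auto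
  then have ind: "indep_var borel ?I borel (\<lambda>\<omega>. g (w e \<omega>))" by (simp add: comp_def)
  have I_int: "integrable M ?I"
    by (rule integrable_const_bound[of _ 1]) (auto simp: indicator_def)
  have I_eq: "(\<integral>\<omega>. ?I \<omega> \<partial>M) = p"
  proof -
    have "(\<integral>\<omega>. ?I \<omega> \<partial>M) = (\<integral>\<omega>. indicator {\<omega> \<in> space M. X e \<omega> = 1} \<omega> \<partial>M)"
      by (intro Bochner_Integration.integral_cong) (auto simp: indicator_def)
    also have "\<dots> = p" using prob_X_1[OF e] by simp
    finally show ?thesis .
  qed
  note gw = integrable_weight[OF e gL g_meas]
  have Ig: "integrable M (\<lambda>\<omega>. ?I \<omega> * g (w e \<omega>))"
    by (rule indep_var_integrable[OF ind I_int gw(1)])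
  have Ig_eq: "(\<integral>\<omega>. ?I \<omega> * g (w e \<omega>) \<partial>M) = p * (\<integral>x. g x \<partial>L)"
    using indep_var_lebesgue_integral[OF ind I_int gw(1)] I_eq gw(2) by simp
  have Y_meas [measurable]: "Y \<in> borel_measurable M"
    unfolding Y_def truncated_weight_def by measurable
  have Y_le: "AE \<omega> in M. Y \<omega> \<le> 1 + ?I \<omega> * g (w e \<omega>)"
    using w_ge_1[OF e]
  proof eventually_elim
    case (elim \<omega>)
    show ?case
    proof (cases "X e \<omega> = 1")
      case True
      define z where "z = min (w e \<omega>) y / y"
      have z: "0 \<le> z" "z \<le> 1" "z \<le> w e \<omega> / y"
        using elim y by (auto simp: z_def divide_simps)
      have "exp z \<le> 1 + z + z\<^sup>2" using z by (intro exp_bound) auto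
      also have "\<dots> \<le> 1 + w e \<omega> / y + (w e \<omega> / y)\<^sup>2"
        using z by (intro add_mono power_mono) auto
      finally show ?thesis using True
        by (simp add: Y_def truncated_weight_def z_def g_def power_divide)
    qed (simp add: Y_def truncated_weight_def)
  qed
  have R: "integrable M (\<lambda>\<omega>. 1 + ?I \<omega> * g (w e \<omega>))" using Ig by simp
  show Yi: "integrable M Y"
  proof (rule Bochner_Integration.integrable_bound[OF R Y_meas])
    show "AE \<omega> in M. norm (Y \<omega>) \<le> norm (1 + ?I \<omega> * g (w e \<omega>))"
      using Y_le
    proof eventually_elim
      case (elim \<omega>)
      moreover have "0 < Y \<omega>" by (simp add: Y_def)
      ultimately show ?case by simp
    qed
  qed
  have "(\<integral>\<omega>. Y \<omega> \<partial>M) \<le> (\<integral>\<omega>. 1 + ?I \<omega> * g (w e \<omega>) \<partial>M)"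
    by (rule integral_mono_AE[OF Yi R Y_le])
  also have "\<dots> = 1 + p * (\<integral>x. g x \<partial>L)"
    using Ig Ig_eq by (simp add: prob_space)
  also have "\<dots> \<le> exp (p * (\<integral>x. g x \<partial>L))"
    by (rule exp_ge_add_one_self)
  finally show "(\<integral>\<omega>. Y \<omega> \<partial>M) \<le> exp (p * ((\<integral>x. x \<partial>L) / y + (\<integral>x. x\<^sup>2 \<partial>L) / y\<^sup>2))"
    by (simp only: intg)
qed

lemma truncated_weight_sum_measurable:
  assumes "F \<subseteq> edges"
  shows "(\<lambda>\<omega>. \<Sum>e\<in>F. truncated_weight y (X e \<omega>) (w e \<omega>)) \<in> borel_measurable M"
proof (rule borel_measurable_sum)
  fix e assume "e \<in> F"
  then have e: "e \<in> edges" using assms by auto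
  note [measurable] = measurable_X[OF e] measurable_w[OF e]
  show "(\<lambda>\<omega>. truncated_weight y (X e \<omega>) (w e \<omega>)) \<in> borel_measurable M"
    unfolding truncated_weight_def by measurable
qed

text \<open>The exponential of the sum divided by \<open>y\<close> is a product of independent
  factors, so its mean is a product of single-edge means; Markov's inequality at level
  \<open>exp (b / y)\<close> finishes.\<close>

lemma prob_truncated_weight_sum:
  assumes F: "F \<subseteq> edges" and y: "0 < y"
    and L: "integrable L (\<lambda>x. x)" "integrable L (\<lambda>x. x\<^sup>2)"
  shows "prob {\<omega> \<in> space M. b \<le> (\<Sum>e\<in>F. truncated_weight y (X e \<omega>) (w e \<omega>))} \<le>
    exp (real (card F) * p * ((\<integral>x. x \<partial>L) / y + (\<integral>x. x\<^sup>2 \<partial>L) / y\<^sup>2) - b / y)"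
proof -
  let ?S = "\<lambda>\<omega>. \<Sum>e\<in>F. truncated_weight y (X e \<omega>) (w e \<omega>)"
  let ?Y = "\<lambda>e \<omega>. exp (truncated_weight y (X e \<omega>) (w e \<omega>) / y)"
  let ?m = "p * ((\<integral>x. x \<partial>L) / y + (\<integral>x. x\<^sup>2 \<partial>L) / y\<^sup>2)"
  have fin: "finite F" using F finite_edges finite_subset by blast
  have [measurable]: "?S \<in> borel_measurable M"
    by (rule truncated_weight_sum_measurable[OF F])
  have indep: "indep_vars (\<lambda>_. borel) ?Y F"
    by (rule indep_vars_subset[OF _ F], rule indep_edges) measurable
  have exp_S: "exp (?S \<omega> / y) = (\<Prod>e\<in>F. ?Y e \<omega>)" for \<omega>
    using fin by (simp add: sum_divide_distrib exp_sum)
  have int: "integrable M (?Y e)" if "e \<in> F" for e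
    using that F exp_moment_truncated_weight(1)[OF _ y L] by blast
  have int_exp: "integrable M (\<lambda>\<omega>. exp (?S \<omega> / y))"
    unfolding exp_S by (rule indep_vars_integrable[OF fin indep int])
  have "{\<omega> \<in> space M. b \<le> ?S \<omega>} = {\<omega> \<in> space M. exp (b / y) \<le> exp (?S \<omega> / y)}"
    using y by (simp add: divide_le_cancel)
  also have "prob \<dots> \<le> (\<integral>\<omega>. exp (?S \<omega> / y) \<partial>M) / exp (b / y)"
    by (rule integral_Markov_inequality_measure[OF int_exp, of "space M"]) auto
  also have "(\<integral>\<omega>. exp (?S \<omega> / y) \<partial>M) = (\<Prod>e\<in>F. \<integral>\<omega>. ?Y e \<omega> \<partial>M)"
    unfolding exp_S by (rule indep_vars_lebesgue_integral[OF fin indep int])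
  also have "(\<Prod>e\<in>F. \<integral>\<omega>. ?Y e \<omega> \<partial>M) / exp (b / y) \<le> (\<Prod>e\<in>F. exp ?m) / exp (b / y)"
    using F exp_moment_truncated_weight(2)[OF _ y L]
    by (intro divide_right_mono prod_mono) (auto intro!: Bochner_Integration.integral_nonneg)
  also have "\<dots> = exp (real (card F) * ?m - b / y)"
    by (simp add: exp_diff flip: exp_of_nat_mult)
  finally show ?thesis by (simp only: mult.assoc)
qed

section \<open>Union bound for the upper tail of the colouring number\<close>

lemma card_edges_le: "card edges \<le> n\<^sup>2"
  using choose_two[of n] by (simp add: card_all_edges power2_eq_square)
    (metis div_le_dividend diff_le_self mult_le_mono2 order_trans)

text \<open>The two error terms belong to two bad events: some present edge is heavier than
  \<open>y\<close>, or the truncated degree of some vertex reaches \<open>b\<close>. Outside both,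
  truncation changes no present edge and the greedy bound applies.\<close>

lemma prob_colouring_number_le:
  assumes n: "n \<ge> 1" and y: "0 < y"
    and L: "integrable L (\<lambda>x. x)" "integrable L (\<lambda>x. x\<^sup>2)"
    and \<mu>: "0 \<le> (\<integral>x. x \<partial>L)"
  shows "prob {\<omega> \<in> space M. real (random_colouring_number n X w \<omega>) \<le> 2 * b + 1} \<ge>
    1 - ((real n)\<^sup>2 * p * measure L {y<..} +
      real n * exp (real n * p * ((\<integral>x. x \<partial>L) / y + (\<integral>x. x\<^sup>2 \<partial>L) / y\<^sup>2) - b / y))"
proof -
  let ?chi = "\<lambda>\<omega>. real (random_colouring_number n X w \<omega>)"
  let ?m = "(\<integral>x. x \<partial>L) / y + (\<integral>x. x\<^sup>2 \<partial>L) / y\<^sup>2"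
  let ?t = "\<lambda>e \<omega>. truncated_weight y (X e \<omega>) (w e \<omega>)"
  \<comment> \<open>Independence is indexed by edges, so a degree is written as a sum over the edges
    at \<open>u\<close>; the injection from \<open>v\<close> to \<open>{u, v}\<close> translates it
    back to neighbours.\<close>
  define F where "F u = {e \<in> edges. u \<in> e}" for u
  define heavy where "heavy = (\<Union>e\<in>edges. {\<omega> \<in> space M. X e \<omega> = 1 \<and> w e \<omega> \<in> {y<..}})"
  define large where "large = (\<Union>u\<in>{1..n}. {\<omega> \<in> space M. b \<le> (\<Sum>e\<in>F u. ?t e \<omega>)})"
  have F_sub: "F u \<subseteq> edges" for u by (auto simp: F_def)
  have F_eq: "F u = (\<lambda>v. {u, v}) ` ({1..n} - {u})" if "u \<in> {1..n}" for u
  proof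
    show "F u \<subseteq> (\<lambda>v. {u, v}) ` ({1..n} - {u})"
    proof
      fix e assume e: "e \<in> F u"
      then have "card e = 2" by (auto simp: F_def all_edges_def)
      then obtain a c where "e = {a, c}" "a \<noteq> c" by (auto simp: card_2_iff)
      with e show "e \<in> (\<lambda>v. {u, v}) ` ({1..n} - {u})"
        by (auto simp: F_def all_edges_def doubleton_eq_iff image_iff)
    qed
  qed (use that in \<open>auto simp: F_def all_edges_def\<close>)
  have inj: "inj_on (\<lambda>v. {u, v}) A" for u :: nat and A
    by (auto simp: inj_on_def doubleton_eq_iff)
  have card_F: "card (F u) \<le> n" if "u \<in> {1..n}" for u
    using that by (simp add: F_eq card_image[OF inj])
  have heavy_ev: "{\<omega> \<in> space M. X e \<omega> = 1 \<and> w e \<omega> \<in> {y<..}} \<in> events" if e: "e \<in> edges" for e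
  proof -
    note [measurable] = measurable_X[OF e] measurable_w[OF e]
    show ?thesis by measurable
  qed
  have large_ev: "{\<omega> \<in> space M. b \<le> (\<Sum>e\<in>F u. ?t e \<omega>)} \<in> events" for u
  proof -
    note [measurable] = truncated_weight_sum_measurable[OF F_sub]
    show ?thesis by measurable
  qed
  have chi_ev: "{\<omega> \<in> space M. ?chi \<omega> \<le> 2 * b + 1} \<in> events"
    using measurable_random_colouring_number[OF n] by measurable
  have "prob heavy \<le> (\<Sum>e\<in>edges. prob {\<omega> \<in> space M. X e \<omega> = 1 \<and> w e \<omega> \<in> {y<..}})"
    unfolding heavy_def using finite_edges heavy_ev
    by (intro finite_measure_subadditive_finite) auto
  also have "\<dots> = (\<Sum>e\<in>edges. p * measure L {y<..})"
    by (intro sum.cong refl prob_present_edge) auto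
  also have "\<dots> = real (card edges) * (p * measure L {y<..})" by simp
  also have "\<dots> \<le> (real n)\<^sup>2 * (p * measure L {y<..})"
    using card_edges_le p_bounds by (intro mult_right_mono) (simp_all flip: of_nat_power)
  finally have heavy: "prob heavy \<le> (real n)\<^sup>2 * p * measure L {y<..}" by (simp add: mult.assoc)
  have "prob large \<le> (\<Sum>u\<in>{1..n}. prob {\<omega> \<in> space M. b \<le> (\<Sum>e\<in>F u. ?t e \<omega>)})"
    unfolding large_def using large_ev by (intro finite_measure_subadditive_finite) auto
  also have "\<dots> \<le> (\<Sum>u\<in>{1..n}. exp (real n * p * ?m - b / y))"
  proof (rule sum_mono)
    fix u assume u: "u \<in> {1..n}"
    have "prob {\<omega> \<in> space M. b \<le> (\<Sum>e\<in>F u. ?t e \<omega>)} \<le> exp (real (card (F u)) * p * ?m - b / y)"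
      by (rule prob_truncated_weight_sum[OF F_sub y L])
    \<comment> \<open>The factor multiplying \<open>card (F u)\<close> is nonnegative, so the degree
      may be replaced by \<open>n\<close>.\<close>
    also have "\<dots> \<le> exp (real n * p * ?m - b / y)"
      using card_F[OF u] p_bounds \<mu> y by (simp add: mult_right_mono)
    finally show "prob {\<omega> \<in> space M. b \<le> (\<Sum>e\<in>F u. ?t e \<omega>)} \<le> exp (real n * p * ?m - b / y)" .
  qed
  also have "\<dots> = real n * exp (real n * p * ?m - b / y)" by simp
  finally have large: "prob large \<le> real n * exp (real n * p * ?m - b / y)" .
  have ev: "heavy \<in> events" "large \<in> events"
    unfolding heavy_def large_def using finite_edges heavy_ev large_ev
    by (auto intro!: sets.finite_UN)
  \<comment> \<open>Weights are at least 1 only almost surely, so the inclusion in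
    \<open>heavy \<union> large\<close> is shown up to a null set.\<close>
  have "AE \<omega> in M. \<forall>e\<in>edges. 1 \<le> w e \<omega>"
    using finite_edges w_ge_1 by (simp add: AE_finite_all)
  then have "AE \<omega> in M. \<omega> \<in> space M - {\<omega> \<in> space M. ?chi \<omega> \<le> 2 * b + 1} \<longrightarrow> \<omega> \<in> heavy \<union> large"
  proof eventually_elim
    case (elim \<omega>)
    show ?case
    proof (intro impI, rule ccontr)
      assume \<omega>: "\<omega> \<in> space M - {\<omega> \<in> space M. ?chi \<omega> \<le> 2 * b + 1}" and no: "\<omega> \<notin> heavy \<union> large"
      let ?E = "random_edges n X \<omega>"
      have light: "w e \<omega> \<le> y" if "e \<in> ?E" for e
        using that no \<omega> by (force simp: heavy_def random_edges_def)
      have deg: "(\<Sum>v | {u, v} \<in> ?E. w {u, v} \<omega>) \<le> b" if u: "u \<in> {1..n}" for u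
      proof -
        have "(\<Sum>v | {u, v} \<in> ?E. w {u, v} \<omega>) = (\<Sum>e\<in>(\<lambda>v. {u, v}) ` {v. {u, v} \<in> ?E}. w e \<omega>)"
          by (simp add: sum.reindex[OF inj])
        also have "(\<lambda>v. {u, v}) ` {v. {u, v} \<in> ?E} = {e \<in> F u. X e \<omega> = 1}"
          using F_eq[OF u] F_sub[of u] by (auto simp: random_edges_def F_def)
        \<comment> \<open>No present edge exceeds \<open>y\<close>, so weights and truncated weights
          agree here; absent edges contribute 0 and are added in the next step.\<close>
        also have "(\<Sum>e\<in>\<dots>. w e \<omega>) = (\<Sum>e | e \<in> F u \<and> X e \<omega> = 1. ?t e \<omega>)"
          using light F_sub[of u]
          by (intro sum.cong) (auto simp: truncated_weight_def random_edges_def min_def)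
        also have "\<dots> = (\<Sum>e\<in>F u. ?t e \<omega>)"
          using finite_subset[OF F_sub finite_edges]
          by (intro sum.mono_neutral_left) (auto simp: truncated_weight_def)
        finally have "(\<Sum>v | {u, v} \<in> ?E. w {u, v} \<omega>) = (\<Sum>e\<in>F u. ?t e \<omega>)" .
        moreover have "\<not> b \<le> (\<Sum>e\<in>F u. ?t e \<omega>)"
          using no \<omega> u unfolding large_def by blast
        ultimately show ?thesis by linarith
      qed
      have "?chi \<omega> \<le> 2 * b + 1"
        unfolding random_colouring_number_def
        using n elim deg by (intro weighted_colouring_number_le_weighted_degree) (auto simp: random_edges_def)
      then show False using \<omega> by simp
    qed
  qed
  then have "prob (space M - {\<omega> \<in> space M. ?chi \<omega> \<le> 2 * b + 1}) \<le> prob (heavy \<union> large)"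
    using ev by (intro finite_measure_mono_AE) auto
  also have "\<dots> \<le> prob heavy + prob large"
    using ev by (rule measure_Un_le)
  finally show ?thesis
    using prob_compl[OF chi_ev] heavy large by linarith
qed

end

section \<open>Asymptotics\<close>

text \<open>\<open>L\<close> is the image of the probability measure under the weight of any one
  edge, and an edge exists from two vertices on.\<close>

lemma (in weighted_random_graph) law_of_weights:
  assumes "n \<ge> 2"
  shows "prob_space L" "sets L = sets borel" "AE x in L. 1 \<le> x"
proof -
  have e: "{1, 2} \<in> edges" using assms by (auto simp: all_edges_def)
  note [measurable] = measurable_w[OF e]
  show "prob_space L"
    unfolding distr_w[OF e, symmetric] by (rule prob_space_distr) measurable
  show "sets L = sets borel" by (simp flip: distr_w[OF e])
  show "AE x in L. 1 \<le> x"
    unfolding distr_w[OF e, symmetric] using w_ge_1[OF e] by (subst AE_distr_iff[OF measurable_w[OF e]]) auto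
qed

text \<open>For \<open>s \<ge> 2\<close> the denominator in the hypothesis is at most
  \<open>2 * real s - 1\<close>. The conclusion is the form that makes the expected number of heavy
  edges decay polynomially.\<close>

lemma one_sub_beta_times_gt_1:
  fixes \<beta> :: real and s :: nat
  assumes "2 \<le> s" "\<beta> < 1 - 1 / (real s + 1 / 2 - 1 / (2 * real s))" "\<beta> < 1"
  shows "(1 - \<beta>) * (2 * real s - 1) > 1"
proof -
  define r where "r = real s + 1 / 2 - 1 / (2 * real s)"
  have "2 \<le> real s" using assms(1) by simp
  moreover from this have "1 / (2 * real s) \<le> 1 / 4" "0 \<le> 1 / (2 * real s)"
    by (simp_all add: field_simps)
  ultimately have r: "0 < r" "r \<le> 2 * real s - 1" unfolding r_def by linarith+
  have "1 / r < 1 - \<beta>" using assms(2) by (simp add: r_def)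
  then have "1 < (1 - \<beta>) * r" using r by (simp add: divide_less_eq)
  also have "\<dots> \<le> (1 - \<beta>) * (2 * real s - 1)" using r assms(3) by (intro mult_left_mono) auto
  finally show ?thesis .
qed

lemma colouring_number_upper_bound:
  fixes M :: "nat \<Rightarrow> 'a measure" and s :: nat
  assumes graph: "\<And>n. weighted_random_graph (M n) n (p n) L (X n) (w n)"
    and \<beta>: "\<beta> < 1" and C: "0 < C" and c: "0 < c" and s: "2 \<le> s"
    and p: "\<And>n. n \<ge> 1 \<Longrightarrow> p n \<ge> 1 / real n powr \<beta>"
    and int: "integrable L (\<lambda>x. x powr (2 * real s + c))"
    and moment: "(\<integral>x. x powr (2 * real s + c) \<partial>L) \<le> C"
    and \<beta>_s: "(1 - \<beta>) * (2 * real s - 1) > 1"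
    and \<epsilon>: "0 < \<epsilon>"
  shows "\<exists>D>0. \<forall>\<^sub>F n in sequentially.
    measure (M n) {\<omega> \<in> space (M n). real (random_colouring_number n (X n) (w n) \<omega>)
      \<le> 2 * (\<integral>x. x \<partial>L) * real n * p n * (1 + \<epsilon>)} \<ge> 1 - 1 / real n powr D"
proof -
  \<comment> \<open>The law is the same for all \<open>n\<close>, so its properties can be read off
    from the graph on two vertices.\<close>
  interpret W2: weighted_random_graph "M 2" 2 "p 2" L "X 2" "w 2" by (rule graph)
  have "sets L = sets borel" and L1: "AE x in L. 1 \<le> x" and "prob_space L"
    using W2.law_of_weights by auto
  interpret L: prob_space L by fact
  have [measurable_cong]: "sets L = sets borel" by fact
  have spL: "space L = UNIV" using sets_eq_imp_space_eq[OF \<open>sets L = sets borel\<close>] by simp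
  define q where "q = 2 * real s + c"
  \<comment> \<open>Almost surely \<open>x \<ge> 1\<close>, so the higher moment dominates the first
    two.\<close>
  have int_pow: "integrable L (\<lambda>x. x ^ k)" if "k \<le> 2" for k :: nat
  proof (rule Bochner_Integration.integrable_bound[OF int])
    show "AE x in L. norm (x ^ k) \<le> norm (x powr (2 * real s + c))"
      using L1
    proof eventually_elim
      case (elim x)
      then have "x ^ k = x powr real k" by (simp add: powr_realpow)
      also have "\<dots> \<le> x powr (2 * real s + c)" using elim that s c by (intro powr_mono) auto
      finally show ?case using elim by simp
    qed
  qed measurable
  have L: "integrable L (\<lambda>x. x)" "integrable L (\<lambda>x. x\<^sup>2)"
    using int_pow[of 1] int_pow[of 2] by simp_all
  define \<mu> where "\<mu> = (\<integral>x. x \<partial>L)"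
  define m2 where "m2 = (\<integral>x. x\<^sup>2 \<partial>L)"
  have "(\<integral>x. 1 \<partial>L) \<le> \<mu>"
    unfolding \<mu>_def using L1 L(1) by (intro integral_mono_AE) auto
  then have \<mu>: "1 \<le> \<mu>" by (simp add: L.prob_space)
  have m2: "0 \<le> m2" unfolding m2_def by simp
  have tail: "measure L {y<..} \<le> C / y powr q" if y: "0 < y" for y
  proof -
    have "measure L {y<..} \<le> measure L {x \<in> space L. y powr q \<le> x powr q}"
      using y c spL by (intro L.finite_measure_mono) (auto simp: q_def intro!: powr_mono2)
    also have "\<dots> \<le> (\<integral>x. x powr q \<partial>L) / y powr q"
      using int y by (intro integral_Markov_inequality_measure[of _ _ "space L"]) (auto simp: q_def)
    also have "\<dots> \<le> C / y powr q"
      using moment by (intro divide_right_mono) (auto simp: q_def)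
    finally show ?thesis .
  qed
  define \<gamma> where "\<gamma> = 1 - \<beta>"
  \<comment> \<open>\<open>D\<close> is the decay exponent in
    \<open>n * (n powr \<gamma>) powr (1 - 2 * s) = n powr (- D)\<close>, the order of the bound for
    heavy edges.\<close>
  define D where "D = \<gamma> * (2 * real s - 1) - 1"
  \<comment> \<open>With \<open>y = d powr \<alpha>\<close> the tail beyond \<open>y\<close> is at
    most \<open>C / d powr (2 * s)\<close>, while \<open>\<alpha> < 1\<close> keeps
    \<open>d / y\<close> a positive power of \<open>d\<close>.\<close>
  define \<alpha> where "\<alpha> = 2 * real s / q"
  \<comment> \<open>The level \<open>b\<close> exceeds the mean bound \<open>\<mu> * d\<close> by
    \<open>2 * k * d\<close>; one \<open>k\<close> absorbs the second moment term, the other remains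
    in the exponent.\<close>
  define k where "k = \<mu> * \<epsilon> / 4"
  have pos: "0 < \<gamma>" "0 < D" "0 < \<alpha>" "0 < 1 - \<alpha>" "0 < k" "0 < q"
    using \<beta> \<beta>_s s c \<mu> \<epsilon> by (auto simp: \<gamma>_def D_def \<alpha>_def k_def q_def)
  have q\<alpha>: "\<alpha> * q = 2 * real s" using pos by (simp add: \<alpha>_def)
  have ev1: "\<forall>\<^sub>F n in sequentially. 1 \<le> \<mu> * \<epsilon> * real n powr \<gamma>"
  proof -
    have "filterlim (\<lambda>n. \<mu> * \<epsilon> * real n powr \<gamma>) at_top sequentially"
      using pos \<mu> \<epsilon> by (intro filterlim_tendsto_pos_mult_at_top[OF tendsto_const]) (auto, real_asymp)
    then show ?thesis by (simp add: filterlim_at_top)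
  qed
  have ev2: "\<forall>\<^sub>F n in sequentially. m2 / k \<le> real n powr (\<gamma> * \<alpha>)"
  proof -
    have "0 < \<gamma> * \<alpha>" using pos by simp
    then have "filterlim (\<lambda>n. real n powr (\<gamma> * \<alpha>)) at_top sequentially" by real_asymp
    then show ?thesis by (simp add: filterlim_at_top)
  qed
  \<comment> \<open>The stretched exponential beats every power of \<open>n\<close>, and halving
    \<open>D\<close> makes room for the constant \<open>C\<close>.\<close>
  have ev3: "\<forall>\<^sub>F n in sequentially.
      C * real n powr (- D) + real n * exp (- (k * real n powr (\<gamma> * (1 - \<alpha>)))) \<le> 1 / real n powr (D / 2)"
  proof -
    define a where "a = \<gamma> * (1 - \<alpha>)"
    have "0 < a" using pos by (simp add: a_def)
    then show ?thesis using pos C unfolding a_def[symmetric] by real_asymp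
  qed
  have "\<forall>\<^sub>F n in sequentially.
    measure (M n) {\<omega> \<in> space (M n). real (random_colouring_number n (X n) (w n) \<omega>)
      \<le> 2 * (\<integral>x. x \<partial>L) * real n * p n * (1 + \<epsilon>)} \<ge> 1 - 1 / real n powr (D / 2)"
    using ev1 ev2 ev3 eventually_ge_at_top[of 1]
  proof eventually_elim
    case (elim n)
    interpret weighted_random_graph "M n" n "p n" L "X n" "w n" by (rule graph)
    define d where "d = real n * p n"
    define y where "y = d powr \<alpha>"
    define b where "b = \<mu> * d * (1 + \<epsilon> / 2)"
    have n: "1 \<le> real n" using elim by simp
    have "real n powr \<gamma> = real n * (1 / real n powr \<beta>)"
      using n by (simp add: \<gamma>_def powr_diff)
    also have "\<dots> \<le> d" unfolding d_def using p[of n] elim by (intro mult_left_mono) auto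
    finally have d: "real n powr \<gamma> \<le> d" .
    have n\<gamma>: "1 \<le> real n powr \<gamma>" using n pos by (simp add: ge_one_powr_ge_zero)
    then have d1: "1 \<le> d" using d by linarith
    have y: "0 < y" using d1 by (simp add: y_def)
    have chi: "{\<omega> \<in> space (M n). real (random_colouring_number n (X n) (w n) \<omega>) \<le> 2 * b + 1}
      \<subseteq> {\<omega> \<in> space (M n). real (random_colouring_number n (X n) (w n) \<omega>)
        \<le> 2 * (\<integral>x. x \<partial>L) * real n * p n * (1 + \<epsilon>)}"
    proof -
      have "1 \<le> \<mu> * \<epsilon> * real n powr \<gamma>" by (rule elim)
      also have "\<dots> \<le> \<mu> * \<epsilon> * d" using d \<mu> \<epsilon> by (intro mult_left_mono) auto
      finally have "2 * b + 1 \<le> 2 * \<mu> * d * (1 + \<epsilon>)" by (simp add: b_def algebra_simps)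
      then show ?thesis by (auto simp: d_def \<mu>_def mult.assoc)
    qed
    have "real n * exp (real n * p n * (\<mu> / y + m2 / y\<^sup>2) - b / y)
      \<le> real n * exp (- (k * real n powr (\<gamma> * (1 - \<alpha>))))"
    proof -
      have "d / y = d powr (1 - \<alpha>)" using d1 by (simp add: y_def powr_diff)
      moreover have "real n powr (\<gamma> * (1 - \<alpha>)) \<le> d powr (1 - \<alpha>)"
        using powr_mono2[of "1 - \<alpha>" "real n powr \<gamma>" d] d pos by (simp add: powr_powr)
      ultimately have dy: "real n powr (\<gamma> * (1 - \<alpha>)) \<le> d / y" by simp
      have "m2 / k \<le> real n powr (\<gamma> * \<alpha>)" by (rule elim)
      also have "\<dots> \<le> y"
        using powr_mono2[of \<alpha> "real n powr \<gamma>" d] d pos by (simp add: powr_powr y_def)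
      finally have "m2 / y \<le> k" using pos y by (simp add: field_simps)
      have "real n * p n * (\<mu> / y + m2 / y\<^sup>2) - b / y = d / y * (m2 / y - 2 * k)"
        using y by (simp add: b_def k_def flip: d_def) (simp add: field_simps power2_eq_square)
      also have "\<dots> \<le> d / y * (- k)"
        using \<open>m2 / y \<le> k\<close> d1 y by (intro mult_left_mono) auto
      also have "\<dots> \<le> - (k * real n powr (\<gamma> * (1 - \<alpha>)))"
        using mult_left_mono[OF dy, of k] pos by (simp add: mult.commute)
      finally show ?thesis by (intro mult_left_mono) auto
    qed
    moreover have "(real n)\<^sup>2 * p n * measure L {y<..} \<le> C * real n powr (- D)"
    proof -
      have yq: "y powr q = d powr (2 * real s)" by (simp add: y_def powr_powr q\<alpha>)
      have "(real n)\<^sup>2 * p n * measure L {y<..} \<le> (real n)\<^sup>2 * p n * (C / d powr (2 * real s))"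
        using tail[OF y] p_bounds by (intro mult_left_mono) (auto simp: yq)
      also have "\<dots> = C * (real n * d powr (1 - 2 * real s))"
        using d1 by (simp add: powr_diff d_def power2_eq_square)
      \<comment> \<open>The exponent \<open>1 - 2 * s\<close> is negative, so the lower bound on
        \<open>d\<close> yields an upper bound here.\<close>
      also have "\<dots> \<le> C * (real n * (real n powr \<gamma>) powr (1 - 2 * real s))"
        using d n n\<gamma> s C by (intro mult_left_mono powr_mono2') auto
      also have "real n * (real n powr \<gamma>) powr (1 - 2 * real s) = real n powr (- D)"
        using n by (simp add: powr_powr D_def powr_mult_base algebra_simps)
      finally show ?thesis .
    qed
    moreover have "1 - ((real n)\<^sup>2 * p n * measure L {y<..} +
        real n * exp (real n * p n * (\<mu> / y + m2 / y\<^sup>2) - b / y))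
      \<le> prob {\<omega> \<in> space (M n). real (random_colouring_number n (X n) (w n) \<omega>) \<le> 2 * b + 1}"
      unfolding \<mu>_def m2_def
      using prob_colouring_number_le[OF _ y L, of b] elim \<mu> by (simp add: \<mu>_def)
    moreover have "\<dots> \<le> prob {\<omega> \<in> space (M n). real (random_colouring_number n (X n) (w n) \<omega>)
        \<le> 2 * (\<integral>x. x \<partial>L) * real n * p n * (1 + \<epsilon>)}"
    proof (rule finite_measure_mono[OF chi])
      have [measurable]: "(\<lambda>\<omega>. real (random_colouring_number n (X n) (w n) \<omega>)) \<in> borel_measurable (M n)"
        using elim by (intro measurable_random_colouring_number) auto
      show "{\<omega> \<in> space (M n). real (random_colouring_number n (X n) (w n) \<omega>)
          \<le> 2 * (\<integral>x. x \<partial>L) * real n * p n * (1 + \<epsilon>)} \<in> events"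
        by measurable
    qed
    ultimately show ?case using elim by linarith
  qed
  then show ?thesis using pos by (intro exI[of _ "D / 2"]) auto
qed

lemma colouring_number_lower_bound:
  fixes M :: "nat \<Rightarrow> 'a measure" and s :: real
  assumes graph: "\<And>n. weighted_random_graph (M n) n (p n) L (X n) (w n)"
    and \<beta>: "\<beta> < 1" and A: "0 < A" and s: "1 < s"
    and p: "\<And>n. n \<ge> 1 \<Longrightarrow> p n = 1 / real n powr \<beta>"
    and tail: "\<And>x. 1 \<le> x \<Longrightarrow> measure L {x..} \<ge> A / x powr (2 * s)"
    and \<beta>_s: "(1 - \<beta>) * (2 * s - 1) < 1"
  shows "\<exists>\<theta>\<^sub>1>0. \<exists>\<theta>\<^sub>2>0. \<forall>\<^sub>F n in sequentially.
    measure (M n) {\<omega> \<in> space (M n). real (random_colouring_number n (X n) (w n) \<omega>)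
      \<ge> real n powr \<theta>\<^sub>1 * (real n * p n)} \<ge> 1 - exp (- (real n powr \<theta>\<^sub>2))"
proof -
  define \<gamma> where "\<gamma> = 1 - \<beta>"
  \<comment> \<open>At weight level \<open>n powr (\<theta> + \<gamma>)\<close> the expected number
    of present edges at least that heavy is at least of order
    \<open>n powr (g - 2 * s * \<theta>)\<close>. The choice of \<theta> spends half of
    \<open>g\<close>.\<close>
  define g where "g = 1 - \<gamma> * (2 * s - 1)"
  define \<theta> where "\<theta> = g / (4 * s)"
  have pos: "0 < \<gamma>" "0 < g" "0 < \<theta>" using \<beta> \<beta>_s s by (auto simp: \<gamma>_def g_def \<theta>_def)
  \<comment> \<open>Of the remaining exponent \<open>g / 2\<close>, half is given up to absorb the
    constant \<open>A / 4\<close>.\<close>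
  have "\<forall>\<^sub>F n in sequentially. real n powr (g / 4) \<le> A / 4 * real n powr (g / 2)"
    using pos A by real_asymp
  then have "\<forall>\<^sub>F n in sequentially.
    measure (M n) {\<omega> \<in> space (M n). real (random_colouring_number n (X n) (w n) \<omega>)
      \<ge> real n powr \<theta> * (real n * p n)} \<ge> 1 - exp (- (real n powr (g / 4)))"
    using eventually_ge_at_top[of 2]
  proof eventually_elim
    case (elim n)
    interpret weighted_random_graph "M n" n "p n" L "X n" "w n" by (rule graph)
    have n: "2 \<le> real n" using elim by simp
    define x where "x = real n powr \<theta> * (real n * p n)"
    have x: "x = real n powr (\<theta> + \<gamma>)"
      using n p[of n] by (simp add: x_def \<gamma>_def powr_diff powr_add)
    \<comment> \<open>The tail hypothesis is available only from 1 on.\<close>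
    have "1 \<le> x" unfolding x using n pos by (intro ge_one_powr_ge_zero) auto
    have "2 * s * (\<theta> + \<gamma>) = 2 - \<beta> - g / 2"
      using s by (simp add: \<theta>_def g_def \<gamma>_def field_simps)
    then have xs: "x powr (2 * s) = real n powr (2 - \<beta> - g / 2)"
      by (simp add: x powr_powr mult.commute)
    have "real n powr (g / 4) \<le> A / 4 * real n powr (g / 2)" by (rule elim)
    also have "\<dots> = p n * (A / x powr (2 * s)) * ((real n)\<^sup>2 / 4)"
    proof -
      \<comment> \<open>The exponents of the three powers add up to 2, so \<open>n\<^sup>2\<close>
        is their product and the identity becomes plain cancellation.\<close>
      define P G B where "P = real n powr \<beta>" and "G = real n powr (g / 2)"
        and "B = real n powr (2 - \<beta> - g / 2)"
      have n2: "(real n)\<^sup>2 = G * (P * B)"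
        using n by (simp add: P_def G_def B_def flip: powr_add powr_numeral)
      have "0 < P" "0 < B" and pB: "p n = 1 / P" "x powr (2 * s) = B"
        using n p[of n] by (simp_all add: P_def B_def xs)
      then show ?thesis unfolding G_def[symmetric] n2 pB by simp
    qed
    also have "\<dots> \<le> p n * measure L {x..} * real (n choose 2)"
    proof (intro mult_mono)
      show "A / x powr (2 * s) \<le> measure L {x..}" by (rule tail[OF \<open>1 \<le> x\<close>])
      \<comment> \<open>\<open>n * (n - 1) / 2 \<ge> n\<^sup>2 / 4\<close> holds precisely because
        \<open>n \<ge> 2\<close>.\<close>
      have "real (n choose 2) = real n * (real n - 1) / 2"
        using elim by (simp add: choose_two real_of_nat_div of_nat_diff)
      then have "2 * real (n choose 2) = real n * real n - real n"
        by (simp add: right_diff_distrib)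
      moreover have "2 * real n \<le> real n * real n" using n by (intro mult_right_mono) auto
      ultimately show "(real n)\<^sup>2 / 4 \<le> real (n choose 2)"
        unfolding power2_eq_square by linarith
    qed (use p_bounds A in auto)
    finally have "1 - exp (- (real n powr (g / 4))) \<le> 1 - exp (- (p n * measure L {x..} * real (n choose 2)))"
      by simp
    also have "\<dots> \<le> prob {\<omega> \<in> space (M n). x \<le> real (random_colouring_number n (X n) (w n) \<omega>)}"
      by (rule prob_colouring_number_ge[OF \<open>2 \<le> n\<close>])
    finally show ?case by (simp add: x_def)
  qed
  then show ?thesis using pos by (intro exI[of _ \<theta>] exI[of _ "g / 4"] conjI) auto
qed

theorem theorem1:
  fixes M :: "nat \<Rightarrow> 'a measure" and p :: "nat \<Rightarrow> real" and L :: "real measure"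
    and X :: "nat \<Rightarrow> nat set \<Rightarrow> 'a \<Rightarrow> real" and w :: "nat \<Rightarrow> nat set \<Rightarrow> 'a \<Rightarrow> real"
  assumes "\<And>n. weighted_random_graph (M n) n (p n) L (X n) (w n)"
  shows
    "(\<forall>(\<beta>::real) (C::real) (c::real) (s::nat).
        0 < \<beta> \<and> \<beta> < 1 \<and> 0 < C \<and> 0 < c \<and> 2 \<le> s \<and>
        (\<forall>n\<ge>1. p n \<ge> 1 / real n powr \<beta>) \<and>
        integrable L (\<lambda>x. x powr (2 * real s + c)) \<and>
        (\<integral>x. x powr (2 * real s + c) \<partial>L) \<le> C \<and>
        \<beta> < 1 - 1 / (real s + 1 / 2 - 1 / (2 * real s)) \<longrightarrow>
        (\<forall>\<epsilon>>0. \<exists>D>0. \<forall>\<^sub>F n in sequentially.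
           measure (M n) {\<omega> \<in> space (M n).
              real (random_colouring_number n (X n) (w n) \<omega>)
                \<le> 2 * (\<integral>x. x \<partial>L) * real n * p n * (1 + \<epsilon>)}
           \<ge> 1 - 1 / real n powr D))
     \<and>
     (\<forall>(\<beta>::real) (A::real) (s::real).
        0 < \<beta> \<and> \<beta> < 1 \<and> 0 < A \<and> 1 < s \<and>
        (\<forall>n\<ge>1. p n = 1 / real n powr \<beta>) \<and>
        (\<forall>x\<ge>1. measure L {x..} \<ge> A / x powr (2 * s)) \<and>
        \<beta> > 1 - 1 / (2 * s - 1) \<longrightarrow>
        (\<exists>\<theta>\<^sub>1>0. \<exists>\<theta>\<^sub>2>0. \<forall>\<^sub>F n in sequentially.
           measure (M n) {\<omega> \<in> space (M n).
              real (random_colouring_number n (X n) (w n) \<omega>)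
                \<ge> real n powr \<theta>\<^sub>1 * (real n * p n)}
           \<ge> 1 - exp (- (real n powr \<theta>\<^sub>2))))"
proof (intro conjI allI impI; elim conjE)
  fix \<beta> C c :: real and s :: nat and \<epsilon> :: real
  assume "0 < \<beta>" "\<beta> < 1" "0 < C" "0 < c" "2 \<le> s" "\<forall>n\<ge>1. p n \<ge> 1 / real n powr \<beta>"
    "integrable L (\<lambda>x. x powr (2 * real s + c))"
    "(\<integral>x. x powr (2 * real s + c) \<partial>L) \<le> C"
    "\<beta> < 1 - 1 / (real s + 1 / 2 - 1 / (2 * real s))" "0 < \<epsilon>"
  then show "\<exists>D>0. \<forall>\<^sub>F n in sequentially.
      measure (M n) {\<omega> \<in> space (M n).
        real (random_colouring_number n (X n) (w n) \<omega>)
          \<le> 2 * (\<integral>x. x \<partial>L) * real n * p n * (1 + \<epsilon>)}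
      \<ge> 1 - 1 / real n powr D"
    using one_sub_beta_times_gt_1[of s \<beta>]
    by (intro colouring_number_upper_bound[OF assms, where \<beta> = \<beta> and C = C and c = c and s = s]) auto
next
  fix \<beta> A s :: real
  assume asm: "0 < \<beta>" "\<beta> < 1" "0 < A" "1 < s" "\<forall>n\<ge>1. p n = 1 / real n powr \<beta>"
    "\<forall>x\<ge>1. measure L {x..} \<ge> A / x powr (2 * s)" "\<beta> > 1 - 1 / (2 * s - 1)"
  \<comment> \<open>Since \<open>s > 1\<close>, the factor \<open>2 * s - 1\<close> is positive and
    the threshold can be multiplied out.\<close>
  then have "(1 - \<beta>) * (2 * s - 1) < 1"
    by (simp add: field_simps)
  with asm show "\<exists>\<theta>\<^sub>1>0. \<exists>\<theta>\<^sub>2>0. \<forall>\<^sub>F n in sequentially.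
      measure (M n) {\<omega> \<in> space (M n).
        real (random_colouring_number n (X n) (w n) \<omega>)
          \<ge> real n powr \<theta>\<^sub>1 * (real n * p n)}
      \<ge> 1 - exp (- (real n powr \<theta>\<^sub>2))"
    by (intro colouring_number_lower_bound[OF assms, where \<beta> = \<beta> and A = A and s = s]) auto
qed

end
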